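(* Let $|\alpha|<\pi/2$. For any $\boldsymbol{\theta}\in\mathcal{S}_\theta^{\dagger}$, the matrix $\mathbf{J}(s)=\mathbf{D}+s\mathbf{A}$ is stable for all $s\in[0,1]$ and unstable for $s>1$. Thus $\mathcal{S}_\theta^{\dagger}\subseteq\mathcal{S}_\theta$, the set of fully synchronous solutions to the Kuramoto--Sakaguchi model. In particular, for $|\alpha|<\pi/2$, the set $\mathcal{S}_\theta^{\dagger}$, and thus $\mathcal{S}_\theta$, is nonempty.
   Context: The Kuramoto--Sakaguchi model is the system $\dot\theta_i=\omega_i+f_i(\boldsymbol{\theta},\alpha)$, $i=1,\dots,n$, on the torus $\mathbb{T}^n$, with $\omega_i\in\mathbb{R}$, $|\alpha|<\pi/2$ and $f_i(\boldsymbol{\theta},\alpha)=\sum_{j=1}^n\big(\sin(\theta_j-\theta_i-\alpha)+\sin\alpha\big)$. Write $\mathbf{f}=(f_1,\dots,f_n)$. The reduced configuration space is $\mathcal{T}=\mathbb{T}^n\cap\mathbf{1}^{\perp}$, i.e. the configurations $\boldsymbol{\theta}=(\theta_1,\dots,\theta_n)$ with $\sum_i\theta_i=0$, where $\mathbf{1}=(1,\dots,1)$. For a configuration $\boldsymbol{\theta}$, $\mathbf{D}$ is the diagonal $n\times n$ matrix with $D_{ii}=-\sum_{j=1}^n\cos(\theta_j-\theta_i-\alpha)$ (the sum includes $j=i$), $\mathbf{A}$ is the $n\times n$ matrix with entries $a_{ij}=\cos(\theta_j-\theta_i-\alpha)$, and $\mathbf{J}(s)=\mathbf{D}+s\mathbf{A}$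 for real $s$. Then $\mathbf{J}=\mathbf{J}(1)$ is the Jacobian matrix $\partial\mathbf{f}/\partial\boldsymbol{\theta}$. It is in general non-symmetric, and it has zero row sums, so $0$ is always an eigenvalue of $\mathbf{J}$. The paper does not formally define "stable" and "unstable" for a matrix; it says that determining the stable and unstable regions is a matter of determining the real parts of the eigenvalues of $\mathbf{J}$ other than this eigenvalue $0$. $\mathcal{S}_\theta$ is the set of configurations in $\mathcal{T}$ for which the Jacobian $\mathbf{J}$ is negative semi-definite with a one-dimensional kernel. $\mathcal{S}_\theta^{\dagger}$ is the set of configurations in $\mathcal{T}$ such that $\cos(\theta_i-\theta_j-\alpha)>0$ for all $i,j$. *)

theory Defs
  imports "HOL-Analysis.Analysis" "HOL-Computational_Algebra.Polynomial"
begin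

section \<open>Spectra of real matrices\<close>

definition complex_eigenvalue :: "real^'n^'n \<Rightarrow> complex \<Rightarrow> bool" where
  "complex_eigenvalue M \<mu> \<longleftrightarrow>
     (\<exists>v. v \<noteq> 0 \<and> map_matrix complex_of_real M *v v = \<mu> *s v)"

definition charpoly :: "real^'n^'n \<Rightarrow> real poly" where
  "charpoly M = det (mat [:0, 1:] - map_matrix (\<lambda>c. [:c:]) M)"

text \<open>
  Stability is judged by the real parts of all eigenvalues except the trivial eigenvalue 0
  that a matrix with zero row sums has because it annihilates the all-ones vector.
  That eigenvalue is discarded only once: the \<open>n - 1\<close> remaining eigenvalues, counted with
  algebraic multiplicity, must all have negative real part, so 0 has to be a simple root of
  the characteristic polynomial. If the row sums of \<open>M\<close> do not all vanish, there is no
  trivial eigenvalue, and every eigenvalue must have negative real part.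
\<close>

definition stable_matrix :: "real^'n^'n \<Rightarrow> bool" where
  "stable_matrix M \<longleftrightarrow>
     (\<forall>\<mu>. complex_eigenvalue M \<mu> \<longrightarrow>
        Re \<mu> < 0 \<or> (\<mu> = 0 \<and> M *v 1 = 0 \<and> order 0 (charpoly M) = 1))"

text \<open>This is not the negation of \<^const>\<open>stable_matrix\<close>.\<close>

definition unstable_matrix :: "real^'n^'n \<Rightarrow> bool" where
  "unstable_matrix M \<longleftrightarrow> (\<exists>\<mu>. complex_eigenvalue M \<mu> \<and> Re \<mu> > 0)"

text \<open>
  Negative semi-definiteness of a matrix that need not be symmetric, in the spectral sense: each
  eigenvalue is 0 or has negative real part. For symmetric matrices this is the usual notion.
  The condition \<open>x \<bullet> (M *v x) \<le> 0\<close> for all \<open>x\<close> is not what is meant for the Jacobian \<open>J\<close> of the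
  Kuramoto--Sakaguchi field: since \<open>J *v 1 = 0\<close>, it would force \<open>transpose J *v 1 = 0\<close>,
  which fails already for two oscillators at angles \<open>t\<close> and \<open>-t\<close>, with \<open>t\<close> and
  \<open>\<alpha>\<close> nonzero and small.
\<close>

definition neg_semidefinite :: "real^'n^'n \<Rightarrow> bool" where
  "neg_semidefinite M \<longleftrightarrow> (\<forall>\<mu>. complex_eigenvalue M \<mu> \<longrightarrow> \<mu> = 0 \<or> Re \<mu> < 0)"


section \<open>The Kuramoto--Sakaguchi model\<close>

definition ks_field :: "real \<Rightarrow> real^'n \<Rightarrow> real^'n" where
  "ks_field \<alpha> \<theta> = (\<chi> i. \<Sum>j\<in>UNIV. sin (\<theta>$j - \<theta>$i - \<alpha>) + sin \<alpha>)"

definition ks_D :: "real \<Rightarrow> real^'n \<Rightarrow> real^'n^'n" where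
  "ks_D \<alpha> \<theta> = (\<chi> i k. if i = k then - (\<Sum>j\<in>UNIV. cos (\<theta>$j - \<theta>$i - \<alpha>)) else 0)"

definition ks_A :: "real \<Rightarrow> real^'n \<Rightarrow> real^'n^'n" where
  "ks_A \<alpha> \<theta> = (\<chi> i j. cos (\<theta>$j - \<theta>$i - \<alpha>))"

definition ks_J :: "real \<Rightarrow> real^'n \<Rightarrow> real \<Rightarrow> real^'n^'n" where
  "ks_J \<alpha> \<theta> s = ks_D \<alpha> \<theta> + s *\<^sub>R ks_A \<alpha> \<theta>"

lemma ks_field_has_derivative:
  "(ks_field \<alpha> has_derivative (\<lambda>h. ks_J \<alpha> \<theta> 1 *v h)) (at \<theta>)"
proof -
  have comp: "(\<lambda>h. (ks_J \<alpha> \<theta> 1 *v h) $ i) =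
      (\<lambda>h. \<Sum>j\<in>UNIV. cos (\<theta>$j - \<theta>$i - \<alpha>) * (h$j - h$i))" for i :: 'a
  proof
    fix h :: "real^'a"
    have "(ks_J \<alpha> \<theta> 1 *v h) $ i = (ks_D \<alpha> \<theta> *v h) $ i + (ks_A \<alpha> \<theta> *v h) $ i"
      by (simp add: ks_J_def matrix_vector_mult_add_rdistrib)
    also have "(ks_D \<alpha> \<theta> *v h) $ i = - (\<Sum>j\<in>UNIV. cos (\<theta>$j - \<theta>$i - \<alpha>)) * h$i"
      by (simp add: ks_D_def matrix_vector_mult_def if_distribR if_distrib[of "\<lambda>x. x * _"]
          cong: if_cong)
    finally show "(ks_J \<alpha> \<theta> 1 *v h) $ i = (\<Sum>j\<in>UNIV. cos (\<theta>$j - \<theta>$i - \<alpha>) * (h$j - h$i))"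
      by (simp add: ks_A_def matrix_vector_mult_def right_diff_distrib sum_subtractf
          sum_distrib_right)
  qed
  have "((\<lambda>\<theta>. ks_field \<alpha> \<theta> $ i) has_derivative (\<lambda>h. (ks_J \<alpha> \<theta> 1 *v h) $ i)) (at \<theta>)"
    for i :: 'a
    unfolding comp ks_field_def
    by (auto intro!: derivative_eq_intros bounded_linear.has_derivative[OF bounded_linear_vec_nth]
        simp: algebra_simps)
  then show ?thesis
    by (subst has_derivative_componentwise_within)
      (auto simp: Basis_vec_def inner_axis)
qed

lemma jacobian_ks_field: "jacobian (ks_field \<alpha>) (at \<theta>) = ks_J \<alpha> \<theta> 1"
  unfolding jacobian_def
  using frechet_derivative_at[OF ks_field_has_derivative[of \<alpha> \<theta>]]
  by (metis matrix_of_matrix_vector_mul)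

text \<open>
  Points of the torus are represented by vectors of real angles; everything below is
  \<open>2\<pi>\<close>-periodic in each angle. A point of the torus whose angles sum to 0 modulo \<open>2\<pi>\<close>
  always has a representative whose angles sum to exactly 0, so nothing is lost by
  requiring the latter.
\<close>

definition reduced_configs :: "(real^'n) set" where
  "reduced_configs = {\<theta>. (\<Sum>i\<in>UNIV. \<theta>$i) = 0}"

definition S_theta :: "real \<Rightarrow> (real^'n) set" where
  "S_theta \<alpha> =
     {\<theta> \<in> reduced_configs.
        neg_semidefinite (jacobian (ks_field \<alpha>) (at \<theta>)) \<and>
        dim {x. jacobian (ks_field \<alpha>) (at \<theta>) *v x = 0} = 1}"

definition S_theta_dagger :: "real \<Rightarrow> (real^'n) set" where
  "S_theta_dagger \<alpha> =
     {\<theta> \<in> reduced_configs. \<forall>i j. cos (\<theta>$i - \<theta>$j - \<alpha>) > 0}"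

end

theory Submission
  imports Defs
begin

text \<open>
  Both halves rest on positivity of the entries of \<open>A\<close> and on the vector \<open>d\<close> of its row sums,
  \<open>J(s) = s A - diag d\<close>. For \<open>0 \<le> s \<le> 1\<close>, Gershgorin's theorem puts every eigenvalue into
  a disc with centre \<open>- d\<^sub>i\<close> and radius \<open>s d\<^sub>i\<close>, which meets the closed right half-plane at most
  in 0, and only if \<open>s = 1\<close>. There a maximum principle shows that \<open>J x = c 1\<close> forces \<open>c = 0\<close> and
  \<open>x\<close> constant, so that 0 is an algebraically simple eigenvalue. For \<open>s > 1\<close> the vector
  \<open>J(s) 1 = (s - 1) d\<close> is positive, and the Perron eigenvalue of \<open>J(s)\<close>, obtained from Brouwer's
  theorem, is at least the smallest row sum of \<open>J(s)\<close>.
\<close>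

section \<open>Matrices whose row sums are subtracted on the diagonal\<close>

definition row_sum :: "real^'n^'n \<Rightarrow> 'n \<Rightarrow> real" where
  "row_sum a i = (\<Sum>j\<in>UNIV. a$i$j)"

definition row_sum_pencil :: "real^'n^'n \<Rightarrow> real \<Rightarrow> real^'n^'n" where
  "row_sum_pencil a s = (\<chi> i j. s * a$i$j - (if i = j then row_sum a i else 0))"

lemma ks_J_eq_row_sum_pencil: "ks_J \<alpha> \<theta> s = row_sum_pencil (ks_A \<alpha> \<theta>) s"
  by (auto simp: ks_J_def ks_D_def ks_A_def row_sum_pencil_def row_sum_def vec_eq_iff)

lemma row_sum_pencil_mult:
  "(row_sum_pencil a s *v x) $ i = s * (\<Sum>j\<in>UNIV. a$i$j * x$j) - row_sum a i * x$i"
proof -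
  have "(row_sum_pencil a s *v x) $ i =
      (\<Sum>j\<in>UNIV. s * (a$i$j * x$j) - (if i = j then row_sum a i * x$j else 0))"
    unfolding matrix_vector_mult_def row_sum_pencil_def vec_lambda_beta
    by (intro sum.cong) (auto simp: algebra_simps)
  then show ?thesis
    by (simp add: sum_subtractf sum_distrib_left)
qed

lemma row_sum_pencil_mult_complex:
  "(map_matrix complex_of_real (row_sum_pencil a s) *v v) $ i =
     s * (\<Sum>j\<in>UNIV. a$i$j * v$j) - row_sum a i * v$i"
proof -
  have "(map_matrix complex_of_real (row_sum_pencil a s) *v v) $ i =
      (\<Sum>j\<in>UNIV. complex_of_real s * (complex_of_real (a$i$j) * v$j) -
        (if i = j then complex_of_real (row_sum a i) * v$j else 0))"
    unfolding matrix_vector_mult_def map_matrix_def row_sum_pencil_def vec_lambda_beta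
    by (intro sum.cong) (auto simp: algebra_simps)
  then show ?thesis
    by (simp add: sum_subtractf sum_distrib_left)
qed

lemma row_sum_pencil_1_mult:
  "(row_sum_pencil a 1 *v x) $ i = (\<Sum>j\<in>UNIV. a$i$j * (x$j - x$i))"
  by (simp add: row_sum_pencil_mult row_sum_def right_diff_distrib sum_subtractf sum_distrib_right)

lemma row_sum_pencil_1_mult_one: "row_sum_pencil a 1 *v 1 = 0"
  by (simp add: vec_eq_iff row_sum_pencil_1_mult)

lemma row_sum_pos: "(\<And>i j. a$i$j > 0) \<Longrightarrow> row_sum a i > 0"
  unfolding row_sum_def by (intro sum_pos) auto

lemma obtain_max_index:
  fixes f :: "'n::finite \<Rightarrow> 'a::linorder"
  obtains i where "\<And>j. f j \<le> f i"
proof -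
  have "Max (range f) \<in> range f"
    by (intro Max_in) auto
  then obtain i where i: "Max (range f) = f i"
    by blast
  show thesis
    by (rule that[of i]) (simp flip: i)
qed

lemma obtain_min_index:
  fixes f :: "'n::finite \<Rightarrow> 'a::linorder"
  obtains i where "\<And>j. f i \<le> f j"
proof -
  have "Min (range f) \<in> range f"
    by (intro Min_in) auto
  then obtain i where i: "Min (range f) = f i"
    by blast
  show thesis
    by (rule that[of i]) (simp flip: i)
qed

section \<open>Location of the spectrum for 0 <= s <= 1\<close>

lemma row_sum_pencil_eigenvalue:
  fixes a :: "real^'n^'n"
  assumes pos: "\<And>i j. a$i$j > 0" and s: "0 \<le> s" "s \<le> 1"
    and ev: "complex_eigenvalue (row_sum_pencil a s) \<mu>"
  shows "Re \<mu> < 0 \<or> (\<mu> = 0 \<and> s = 1)"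
proof -
  obtain v where v: "v \<noteq> 0" "map_matrix complex_of_real (row_sum_pencil a s) *v v = \<mu> *s v"
    using ev unfolding complex_eigenvalue_def by blast
  obtain i where i: "\<And>j. cmod (v$j) \<le> cmod (v$i)"
    using obtain_max_index[of "\<lambda>j. cmod (v$j)"] by blast
  define d where "d = row_sum a i"
  have d: "d > 0"
    unfolding d_def using pos by (rule row_sum_pos)
  have vi: "cmod (v$i) > 0"
  proof (rule ccontr)
    assume "\<not> cmod (v$i) > 0"
    then have "v$j = 0" for j
      using i[of j] by auto
    with v(1) show False
      by (simp add: vec_eq_iff)
  qed
  \<comment> \<open>The diagonal term s a_ii stays in the sum, so the disc is centred at -d. It
    contains the usual Gershgorin disc of row \<open>i\<close>, and its radius is simply s
    d.\<close>
  have "(\<mu> + d) * v$i = s * (\<Sum>j\<in>UNIV. a$i$j * v$j)"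
    using arg_cong[OF v(2), of "\<lambda>w. w$i"]
    by (simp add: row_sum_pencil_mult_complex d_def algebra_simps)
  then have "cmod (\<mu> + d) * cmod (v$i) = s * cmod (\<Sum>j\<in>UNIV. a$i$j * v$j)"
    using s by (metis abs_of_nonneg norm_mult norm_of_real)
  also have "\<dots> \<le> s * (\<Sum>j\<in>UNIV. a$i$j * cmod (v$i))"
    using pos i s
    by (intro mult_left_mono sum_norm_le) (auto simp: norm_mult less_imp_le intro!: mult_mono)
  also have "\<dots> = s * d * cmod (v$i)"
    by (simp add: d_def row_sum_def sum_distrib_right)
  finally have disc: "cmod (\<mu> + d) \<le> s * d"
    using vi by simp
  have sd: "s * d \<le> d"
    using s d by simp
  show ?thesis
  proof (cases "Re \<mu> < 0")
    case False
    have "Re \<mu> + d \<le> cmod (\<mu> + d)"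
      using complex_Re_le_cmod[of "\<mu> + d"] by simp
    \<comment> \<open>All inequalities in d <= Re \<mu> + d <= |\<mu> + d| <= s d <= d must be
      equalities.\<close>
    then have eq: "Re \<mu> = 0" "s * d = d" "cmod (\<mu> + d) = d"
      using disc sd False by linarith+
    have "(Im \<mu>)\<^sup>2 = 0"
      using eq cmod_power2[of "\<mu> + d"] by simp
    with eq d show ?thesis
      by (auto simp: complex_eq_iff)
  qed simp
qed

section \<open>Maximum principle and kernel at s = 1\<close>

text \<open>The terms a_ij (x_j - x_i) of a row are all <= 0 where x is maximal and all >= 0 where
  it is minimal, so c has both signs. With c = 0 every term of the maximal row vanishes, and
  positivity of the entries makes x constant. Allowing nonzero c is what later yields algebraic, not
  just geometric, simplicity of 0.\<close>

lemma row_sum_pencil_1_maximum_principle: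
  fixes a :: "real^'n^'n"
  assumes pos: "\<And>i j. a$i$j > 0" and eq: "\<And>i. (row_sum_pencil a 1 *v x) $ i = c"
  shows "c = 0" and "x$i = x$j"
proof -
  obtain k where k: "\<And>j. x$j \<le> x$k"
    using obtain_max_index[of "\<lambda>j. x$j"] by blast
  obtain l where l: "\<And>j. x$l \<le> x$j"
    using obtain_min_index[of "\<lambda>j. x$j"] by blast
  have nonneg: "a$k$j * (x$k - x$j) \<ge> 0" for j
    using pos[of k j] k[of j] by simp
  have c: "c = - (\<Sum>j\<in>UNIV. a$k$j * (x$k - x$j))"
    using eq[of k] unfolding row_sum_pencil_1_mult
    by (simp add: right_diff_distrib sum_subtractf)
  have "c \<le> 0"
    unfolding c using nonneg by (simp add: sum_nonneg)
  moreover have "c \<ge> 0"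
    using eq[of l] pos l unfolding row_sum_pencil_1_mult
    by (metis (no_types, lifting) diff_ge_0_iff_ge less_imp_le mult_nonneg_nonneg sum_nonneg)
  ultimately show "c = 0"
    by simp
  then have "a$k$j * (x$k - x$j) = 0" for j
    using c nonneg sum_nonneg_eq_0_iff[of UNIV "\<lambda>j. a$k$j * (x$k - x$j)"] by simp
  then have "x$j = x$k" for j
    using pos[of k j] by (metis eq_iff_diff_eq_0 less_irrefl mult_eq_0_iff)
  from this[of i] this[of j] show "x$i = x$j"
    by simp
qed

lemma dim_kernel_row_sum_pencil_1:
  fixes a :: "real^'n^'n"
  assumes pos: "\<And>i j. a$i$j > 0"
  shows "dim {x. row_sum_pencil a 1 *v x = 0} = 1"
proof -
  have "{x. row_sum_pencil a 1 *v x = 0} = span {1}"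
  proof (intro set_eqI iffI)
    fix x assume "x \<in> {x. row_sum_pencil a 1 *v x = 0}"
    then have "x$i = x$j" for i j
      using row_sum_pencil_1_maximum_principle(2)[OF pos, of x 0] by simp
    \<comment> \<open>All coordinates agree, so \<open>undefined\<close> serves as an arbitrary
      index.\<close>
    then have "x = x$undefined *\<^sub>R 1"
      by (simp add: vec_eq_iff)
    then show "x \<in> span {1}"
      by (metis insertI1 span_base span_scale)
  next
    fix x :: "real^'n" assume "x \<in> span {1}"
    then obtain c where "x = c *\<^sub>R 1"
      by (auto simp: span_singleton)
    then show "x \<in> {x. row_sum_pencil a 1 *v x = 0}"
      by (simp add: row_sum_pencil_1_mult_one matrix_vector_mult_scaleR)
  qed
  moreover have "independent {1 :: real^'n}"
    by (simp add: vec_eq_iff)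
  ultimately show ?thesis
    using dim_span_eq_card_independent[of "{1 :: real^'n}"] by simp
qed

section \<open>Algebraic simplicity of the eigenvalue 0\<close>

lemma poly_det: "poly (det P) t = det (map_matrix (\<lambda>p. poly p t) P)"
  for P :: "'a::comm_ring_1 poly^'n^'n"
proof -
  \<comment> \<open>Evaluation commutes with the sums and products in the determinant; this covers
    the permutation signs, which are embedded integers.\<close>
  have "poly (of_int (k::int)) t = (of_int k :: 'a)" for k
    by (cases k rule: int_cases2) simp_all
  then show ?thesis
    unfolding det_def by (simp add: poly_sum poly_prod)
qed

lemma poly_charpoly: "poly (charpoly M) t = det (mat t - M)"
  unfolding charpoly_def poly_det
  by (rule arg_cong[of _ _ det]) (simp add: vec_eq_iff mat_def)

text \<open>
  With \<open>M 1 = 0\<close>, adding all columns of \<open>t I - M\<close> to column \<open>k\<close> turns it into \<open>t 1\<close>; splitting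
  off the factor \<open>t\<close> leaves a polynomial whose value at 0 is the determinant below.
\<close>

lemma order_charpoly_eq_1:
  fixes M :: "real^'n^'n"
  assumes M1: "M *v 1 = 0"
    and nz: "det (\<chi> i j. if j = k then 1 else - M$i$j) \<noteq> 0"
  shows "order 0 (charpoly M) = 1"
proof -
  define B where "B = (\<lambda>t. (\<chi> i j. if j = k then 1 else (mat t - M)$i$j) :: real^'n^'n)"
  define q where "q = det (\<chi> i j. if j = k then 1
      else (mat [:0, 1:] - map_matrix (\<lambda>c. [:c:]) M)$i$j)"
  have q: "poly q t = det (B t)" for t
    unfolding q_def poly_det B_def
    by (rule arg_cong[of _ _ det]) (simp add: vec_eq_iff mat_def)
  have "poly (charpoly M) t = poly ([:0, 1:] * q) t" for t
  proof -
    let ?A = "mat t - M"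
    have "?A *v 1 = mat t *v 1"
      by (simp add: matrix_vector_mult_diff_rdistrib M1)
    then have A1: "(?A *v 1) $ i = t" for i
      by (simp add: matrix_vector_mult_def mat_def)
    have B1: "(B t *v (t *s axis k 1)) $ i = t" for i
      by (simp add: B_def matrix_vector_mult_def axis_def if_distrib if_distribR cong: if_cong)
    \<comment> \<open>Cramer's lemma for the vector 1, whose coordinate k is 1: replacing column k
      by the sum of all columns preserves the determinant.\<close>
    have "det ?A = det (\<chi> i j. if j = k then t else ?A$i$j)"
      using cramer_lemma[where A = ?A and x = 1 and k = k] by (simp only: A1 one_index mult_1)
    \<comment> \<open>The same lemma for \<open>B t\<close> and t e_k, read backwards, extracts the
      factor t from column k.\<close>
    also have "\<dots> = det (\<chi> i j. if j = k then (B t *v (t *s axis k 1)) $ i else B t$i$j)"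
      unfolding B1 by (rule arg_cong[of _ _ det]) (simp add: vec_eq_iff B_def)
    also have "\<dots> = t * det (B t)"
      unfolding cramer_lemma by (simp add: axis_def)
    finally show ?thesis
      by (simp add: poly_charpoly q)
  qed
  then have charpoly: "charpoly M = [:0, 1:] * q"
    by (simp add: poly_eq_poly_eq_iff[symmetric] fun_eq_iff)
  have "B 0 = (\<chi> i j. if j = k then 1 else - M$i$j)"
    by (simp add: B_def vec_eq_iff mat_def)
  then have q0: "poly q 0 \<noteq> 0"
    using nz by (simp add: q)
  then have "[:0, 1:] * q \<noteq> 0"
    by auto
  then have "order 0 ([:0, 1:] * q) = order 0 [:0, 1 :: real:] + order 0 q"
    by (rule order_mult)
  also have "order 0 [:0, 1 :: real:] = 1"
    using order_power_n_n[of "0 :: real" 1] by simp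
  also have "order 0 q = 0"
    using q0 by (rule order_0I)
  finally show ?thesis
    by (simp add: charpoly)
qed

lemma order_charpoly_row_sum_pencil_1:
  fixes a :: "real^'n^'n"
  assumes pos: "\<And>i j. a$i$j > 0"
  shows "order 0 (charpoly (row_sum_pencil a 1)) = 1"
proof -
  let ?M = "row_sum_pencil a 1"
  fix k :: 'n
  define B where "B = (\<chi> i j. if j = k then 1 else - ?M$i$j)"
  have "x = 0" if Bx: "B *v x = 0" for x
  proof -
    \<comment> \<open>Moving column k to the other side, B x = 0 reads M y = x_k 1. The maximum
      principle then gives x_k = 0 and y constant, hence y = 0 because y_k = 0.\<close>
    define y where "y = (\<chi> j. if j = k then 0 else x$j)"
    have "(?M *v y) $ i = x$k" for i
    proof -
      have "(B *v x) $ i = (\<Sum>j\<in>UNIV. (if j = k then x$j else 0) - ?M$i$j * y$j)"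
        unfolding matrix_vector_mult_def vec_lambda_beta
        by (intro sum.cong) (auto simp: B_def y_def)
      also have "\<dots> = x$k - (?M *v y) $ i"
        by (simp add: sum_subtractf matrix_vector_mult_def)
      finally show ?thesis
        using Bx by simp
    qed
    note y = row_sum_pencil_1_maximum_principle[OF pos this]
    show "x = 0"
      unfolding vec_eq_iff
    proof
      fix j
      show "x$j = 0$j"
        using y(1) y(2)[of j k] by (cases "j = k") (auto simp: y_def)
    qed
  qed
  then have "det B \<noteq> 0"
    using matrix_left_invertible_ker invertible_left_inverse invertible_det_nz by metis
  then show ?thesis
    unfolding B_def by (rule order_charpoly_eq_1[OF row_sum_pencil_1_mult_one])
qed

lemma stable_row_sum_pencil:
  fixes a :: "real^'n^'n"
  assumes "\<And>i j. a$i$j > 0" "0 \<le> s" "s \<le> 1"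
  shows "stable_matrix (row_sum_pencil a s)"
  unfolding stable_matrix_def
  using row_sum_pencil_eigenvalue[OF assms] order_charpoly_row_sum_pencil_1[OF assms(1)]
    row_sum_pencil_1_mult_one
  by blast

section \<open>Perron eigenvector and instability for s > 1\<close>

text \<open>Brouwer's theorem applies to x -> M x / \<open>\<sigma>\<close> x on the standard
  simplex \<open>S\<close>. A fixed point is an eigenvector with eigenvalue \<open>\<sigma>\<close>
  x, and it is strictly positive because M maps \<open>S\<close> to positive vectors.\<close>

lemma positive_matrix_eigenvector:
  fixes M :: "real^'n^'n"
  assumes pos: "\<And>i j. M$i$j > 0"
  obtains x \<rho> where "\<And>i. x$i > 0" "M *v x = \<rho> *s x"
proof -
  define S where "S = {x :: real^'n. (\<forall>i. 0 \<le> x$i) \<and> (\<Sum>i\<in>UNIV. x$i) = 1}"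
  define \<sigma> where "\<sigma> = (\<lambda>x. \<Sum>i\<in>UNIV. (M *v x)$i)"
  have Mx: "(M *v x)$i > 0" if "x \<in> S" for x i
  proof -
    obtain j where "x$j \<noteq> 0"
      using \<open>x \<in> S\<close> by (fastforce simp: S_def)
    with \<open>x \<in> S\<close> pos[of i j] have "M$i$j * x$j > 0"
      by (simp add: S_def less_le)
    moreover have "M$i$k * x$k \<ge> 0" for k
      using \<open>x \<in> S\<close> pos[of i k] by (simp add: S_def)
    ultimately show ?thesis
      unfolding matrix_vector_mult_def vec_lambda_beta by (intro sum_pos2[of _ j]) auto
  qed
  then have \<sigma>: "\<sigma> x > 0" if "x \<in> S" for x
    using that unfolding \<sigma>_def by (intro sum_pos) auto
  have "closed S"
  proof -
    have "S = (\<Inter>i. {x. 0 \<le> x$i}) \<inter> {x. (\<Sum>i\<in>UNIV. x$i) = 1}"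
      by (auto simp: S_def)
    then show ?thesis
      by (auto intro!: closed_Int closed_INT closed_Collect_le closed_Collect_eq continuous_intros)
  qed
  moreover have "S \<subseteq> cbox 0 1"
  proof
    fix x assume x: "x \<in> S"
    then have "x$i \<le> (\<Sum>i\<in>UNIV. x$i)" for i
      by (intro member_le_sum) (auto simp: S_def)
    with x show "x \<in> cbox 0 1"
      by (auto simp: S_def mem_box_cart)
  qed
  ultimately have "compact S"
    by (meson bounded_cbox bounded_subset compact_eq_bounded_closed)
  moreover have "convex S"
    by (auto simp: S_def convex_def sum.distrib simp flip: sum_distrib_left)
  moreover have "axis undefined 1 \<in> S"
    by (simp add: S_def axis_def)
  moreover have "continuous_on S (\<lambda>x. (1 / \<sigma> x) *\<^sub>R (M *v x))"
    using \<sigma> unfolding \<sigma>_def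
    by (intro continuous_intros linear_continuous_on matrix_vector_mul_bounded_linear) fastforce
  moreover have "(\<lambda>x. (1 / \<sigma> x) *\<^sub>R (M *v x)) \<in> S \<rightarrow> S"
  proof
    fix x assume "x \<in> S"
    with Mx \<sigma> have "\<sigma> x > 0" "\<And>i. (M *v x)$i > 0"
      by auto
    then show "(1 / \<sigma> x) *\<^sub>R (M *v x) \<in> S"
      by (auto simp: S_def \<sigma>_def less_imp_le simp flip: sum_divide_distrib)
  qed
  ultimately obtain x where x: "x \<in> S" and fix_x: "(1 / \<sigma> x) *\<^sub>R (M *v x) = x"
    using brouwer[of S "\<lambda>x. (1 / \<sigma> x) *\<^sub>R (M *v x)"] by auto
  have "x$i > 0" for i
    using Mx[OF x, of i] \<sigma>[OF x] arg_cong[OF fix_x, of "\<lambda>w. w$i"] by (metis divide_pos_pos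
        divide_inverse inverse_eq_divide mult.commute real_scaleR_def vector_scaleR_component)
  moreover have "M *v x = \<sigma> x *s x"
    using \<sigma>[OF x] fix_x by (metis divide_inverse less_irrefl mult_1 right_inverse scaleR_one
        scaleR_scaleR scalar_mult_eq_scaleR)
  ultimately show thesis
    by (rule that)
qed

lemma unstable_row_sum_pencil:
  fixes a :: "real^'n^'n"
  assumes pos: "\<And>i j. a$i$j > 0" and s: "s > 1"
  shows "unstable_matrix (row_sum_pencil a s)"
proof -
  let ?J = "row_sum_pencil a s"
  \<comment> \<open>The total of all entries bounds each row sum, so the shift by c makes the
    possibly negative diagonal positive and leaves the eigenvectors unchanged.\<close>
  define c where "c = (\<Sum>i\<in>UNIV. row_sum a i)"
  have c: "row_sum a i \<le> c" for i
    unfolding c_def using row_sum_pos[OF pos] by (intro member_le_sum) (auto simp: less_imp_le)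
  have sa: "s * a$i$j > 0" for i j
    using pos[of i j] s by simp
  have "(?J + mat c)$i$j > 0" for i j
    using sa[of i j] c[of i] by (auto simp: row_sum_pencil_def mat_def)
  then obtain x \<rho> where x: "\<And>i. x$i > 0" and \<rho>: "(?J + mat c) *v x = \<rho> *s x"
    using positive_matrix_eigenvector by blast
  define r where "r = \<rho> - c"
  have "mat c *v x = c *s x"
    by (simp add: vec_eq_iff matrix_vector_mult_def mat_def if_distrib if_distribR cong: if_cong)
  with \<rho> have r: "?J *v x = r *s x"
    by (simp add: r_def matrix_vector_mult_add_rdistrib vector_sub_rdistrib eq_diff_eq)
  \<comment> \<open>At a minimal coordinate x_i, replacing each x_j by x_i can only lower row i, so
    r x_i >= (s - 1) d_i x_i > 0.\<close>
  obtain i where i: "\<And>j. x$i \<le> x$j"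
    using obtain_min_index[of "\<lambda>j. x$j"] by blast
  have "0 < (s - 1) * row_sum a i * x$i"
    using s x row_sum_pos[OF pos] by simp
  also have "\<dots> = s * (\<Sum>j\<in>UNIV. a$i$j * x$i) - row_sum a i * x$i"
    by (simp add: row_sum_def left_diff_distrib sum_distrib_right)
  also have "\<dots> \<le> s * (\<Sum>j\<in>UNIV. a$i$j * x$j) - row_sum a i * x$i"
    using s pos i by (intro diff_right_mono mult_left_mono sum_mono) (auto simp: less_imp_le)
  also have "\<dots> = r * x$i"
    using arg_cong[OF r, of "\<lambda>w. w$i"] by (simp add: row_sum_pencil_mult)
  finally have "r > 0"
    using x[of i] by (simp add: zero_less_mult_iff)
  moreover have "complex_eigenvalue ?J (complex_of_real r)"
    unfolding complex_eigenvalue_def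
  proof (intro exI conjI)
    let ?v = "\<chi> j. complex_of_real (x$j)"
    show "?v \<noteq> 0"
      using x by (metis less_irrefl of_real_eq_0_iff vec_lambda_beta zero_index)
    have "map_matrix complex_of_real ?J *v ?v = (\<chi> j. complex_of_real ((?J *v x)$j))"
      by (simp add: vec_eq_iff matrix_vector_mult_def)
    then show "map_matrix complex_of_real ?J *v ?v = complex_of_real r *s ?v"
      by (simp add: r vec_eq_iff)
  qed
  ultimately show ?thesis
    unfolding unstable_matrix_def by (metis Re_complex_of_real)
qed

section \<open>Application to the Kuramoto--Sakaguchi model\<close>

lemma ks_A_pos: "\<theta> \<in> S_theta_dagger \<alpha> \<Longrightarrow> ks_A \<alpha> \<theta> $ i $ j > 0"
  by (simp add: S_theta_dagger_def ks_A_def)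

lemma S_theta_dagger_subset_S_theta: "S_theta_dagger \<alpha> \<subseteq> S_theta \<alpha>"
proof
  fix \<theta> :: "real^'n" assume \<theta>: "\<theta> \<in> S_theta_dagger \<alpha>"
  note pos = ks_A_pos[OF \<theta>]
  have "neg_semidefinite (row_sum_pencil (ks_A \<alpha> \<theta>) 1)"
    unfolding neg_semidefinite_def
    using row_sum_pencil_eigenvalue[OF pos, where s = 1] by auto
  then show "\<theta> \<in> S_theta \<alpha>"
    using \<theta> dim_kernel_row_sum_pencil_1[OF pos]
    by (simp add: S_theta_def S_theta_dagger_def jacobian_ks_field ks_J_eq_row_sum_pencil)
qed

text \<open>At full phase synchrony every cosine equals cos(-\<alpha>).\<close>

lemma zero_in_S_theta_dagger: "\<bar>\<alpha>\<bar> < pi / 2 \<Longrightarrow> 0 \<in> S_theta_dagger \<alpha>"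
  by (simp add: S_theta_dagger_def reduced_configs_def cos_gt_zero_pi abs_less_iff)

theorem theorem2p4:
  fixes \<alpha> :: real
  assumes "\<bar>\<alpha>\<bar> < pi / 2"
  shows "(\<forall>\<theta> \<in> (S_theta_dagger \<alpha> :: (real^'n) set).
            (\<forall>s\<in>{0..1}. stable_matrix (ks_J \<alpha> \<theta> s)) \<and> (\<forall>s>1. unstable_matrix (ks_J \<alpha> \<theta> s))) \<and>
         (S_theta_dagger \<alpha> :: (real^'n) set) \<subseteq> S_theta \<alpha> \<and>
         (S_theta_dagger \<alpha> :: (real^'n) set) \<noteq> {} \<and>
         (S_theta \<alpha> :: (real^'n) set) \<noteq> {}"
proof (intro conjI ballI allI impI)
  fix \<theta> :: "real^'n" and s :: real
  assume \<theta>: "\<theta> \<in> S_theta_dagger \<alpha>"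
  show "stable_matrix (ks_J \<alpha> \<theta> s)" if "s \<in> {0..1}"
    using stable_row_sum_pencil[OF ks_A_pos[OF \<theta>]] that by (simp add: ks_J_eq_row_sum_pencil)
  show "unstable_matrix (ks_J \<alpha> \<theta> s)" if "s > 1"
    using unstable_row_sum_pencil[OF ks_A_pos[OF \<theta>] that] by (simp add: ks_J_eq_row_sum_pencil)
next
  show "(S_theta_dagger \<alpha> :: (real^'n) set) \<subseteq> S_theta \<alpha>"
    by (rule S_theta_dagger_subset_S_theta)
  show "(S_theta_dagger \<alpha> :: (real^'n) set) \<noteq> {}" "(S_theta \<alpha> :: (real^'n) set) \<noteq> {}"
    using zero_in_S_theta_dagger[OF assms] S_theta_dagger_subset_S_theta by blast+
qed

end
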